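(* Let $n,m\ge 1$ and $s,t$ be integers, let $c_{uv}$ ($1\le u\le n$, $1\le v\le m$) be complex numbers, and let $\Psi:\mathbb{Z}^2\to\mathbb{C}$ be a given function. Consider the linear partial difference equation $$U_{i+s,j+t,k+1}=\sum_{u=1}^{n}\sum_{v=1}^{m}c_{uv}\,U_{i+u-1,\,j+v-1,\,k}\qquad (i,j\in\mathbb{Z},\ k\in\mathbb{N}\cup\{0\})$$ for an unknown function $U:\mathbb{Z}^2\times(\mathbb{N}\cup\{0\})\to\mathbb{C}$, $(i,j,k)\mapsto U_{i,j,k}$, with the initial condition $U_{i,j,0}=\Psi(i,j)$ for all $i,j\in\mathbb{Z}$. Then its solution is given, for all $i,j\in\mathbb{Z}$ and $k\in\mathbb{N}\cup\{0\}$, by $$U_{i,j,k}=\sum_{(s_{uv})\in I}\binom{k}{s_{11},s_{12},\dots,s_{1m},\dots,s_{nm}}\,\Psi(i-a,j-b)\prod_{u=1}^{n}\prod_{v=1}^{m}c_{uv}^{s_{uv}},$$ where $I$ is the set of all families of integers $(s_{uv})_{1\le u\le n,\,1\le v\le m}$ with $0\le s_{uv}\le k$ for all $u,v$ and $\sum_{u=1}^{n}\sum_{v=1}^{m}s_{uv}=k$, and, for each such family, $$a=(s+1)k-\sum_{u=1}^{n}\sum_{v=1}^{m}u\,s_{uv},\qquad b=(t+1)k-\sum_{u=1}^{n}\sum_{v=1}^{m}v\,s_{uv}.$$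
   Context: $\mathbb{N}=\{1,2,\dots\}$. The symbol $\binom{k}{s_{11},\dots,s_{nm}}=\frac{k!}{\prod_{u,v}s_{uv}!}$ (for nonnegative integers $s_{uv}$ with $\sum_{u,v}s_{uv}=k$) is the multinomial coefficient. The convention $0^0=1$ is used in powers of coefficients. The integers $s,t$ (shifts) are unrelated to the summation indices $s_{uv}$. *)

theory Defs
  imports Complex_Main "HOL-Library.FuncSet"
begin

text \<open>Families \<open>(s\<^sub>u\<^sub>v)\<close>, \<open>1 \<le> u \<le> n\<close>, \<open>1 \<le> v \<le> m\<close>, are extensional functions on the index
  grid, so that each family is represented by exactly one element of \<open>multi_indices n m k\<close>.\<close>

definition grid :: "nat \<Rightarrow> nat \<Rightarrow> (nat \<times> nat) set" where
  "grid n m = {1..n} \<times> {1..m}"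

definition multi_indices :: "nat \<Rightarrow> nat \<Rightarrow> nat \<Rightarrow> (nat \<times> nat \<Rightarrow> nat) set" where
  "multi_indices n m k =
     {\<sigma> \<in> grid n m \<rightarrow>\<^sub>E {0..k}. (\<Sum>u=1..n. \<Sum>v=1..m. \<sigma> (u, v)) = k}"

text \<open>A quotient of complex numbers, so no rounding takes place.\<close>

definition multinomial :: "nat \<Rightarrow> nat \<Rightarrow> nat \<Rightarrow> (nat \<times> nat \<Rightarrow> nat) \<Rightarrow> complex" where
  "multinomial n m k \<sigma> = fact k / (\<Prod>u=1..n. \<Prod>v=1..m. fact (\<sigma> (u, v)))"

definition solves_difference_eq ::
  "nat \<Rightarrow> nat \<Rightarrow> int \<Rightarrow> int \<Rightarrow> (nat \<Rightarrow> nat \<Rightarrow> complex) \<Rightarrow> (int \<Rightarrow> int \<Rightarrow> nat \<Rightarrow> complex) \<Rightarrow> bool" where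
  "solves_difference_eq n m s t c U \<longleftrightarrow>
     (\<forall>i j k. U (i + s) (j + t) (k + 1) =
        (\<Sum>u=1..n. \<Sum>v=1..m. c u v * U (i + int u - 1) (j + int v - 1) k))"

definition shift_a :: "nat \<Rightarrow> nat \<Rightarrow> int \<Rightarrow> nat \<Rightarrow> (nat \<times> nat \<Rightarrow> nat) \<Rightarrow> int" where
  "shift_a n m s k \<sigma> = (s + 1) * int k - (\<Sum>u=1..n. \<Sum>v=1..m. int u * int (\<sigma> (u, v)))"

definition shift_b :: "nat \<Rightarrow> nat \<Rightarrow> int \<Rightarrow> nat \<Rightarrow> (nat \<times> nat \<Rightarrow> nat) \<Rightarrow> int" where
  "shift_b n m t k \<sigma> = (t + 1) * int k - (\<Sum>u=1..n. \<Sum>v=1..m. int v * int (\<sigma> (u, v)))"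

end

theory Submission
  imports Defs
begin

text \<open>
  Read forwards in \<open>k\<close>, the equation determines every layer from the one before it, because the
  shift by \<open>(s, t)\<close> is a bijection of the plane. A solution is therefore fixed by its initial layer,
  and the equivalence amounts to one claim: the explicit formula solves the initial value problem.

  In combinatorial terms the equation says that a walker makes \<open>k\<close> steps, each of a type \<open>(u, v)\<close>
  with weight \<open>c u v\<close> and displacement \<open>(u - 1 - s, v - 1 - t)\<close>. Since displacements commute, only
  the numbers \<open>\<sigma> (u, v)\<close> of steps of each type matter, and the multinomial coefficient counts the
  orders in which those steps can be made. Splitting off one step is the recurrence
  \<open>sum_multinomial_Suc\<close> for multinomial coefficients, tested against an arbitrary function of
  \<open>\<sigma>\<close>. It remains to observe how displacement and weight change when one step is added.
\<close>

section \<open>A recurrence for multinomial sums\<close>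

definition weak_compositions :: "'a set \<Rightarrow> nat \<Rightarrow> ('a \<Rightarrow> nat) set" where
  "weak_compositions G k = {\<sigma> \<in> G \<rightarrow>\<^sub>E {0..k}. sum \<sigma> G = k}"

lemma weak_compositions_iff:
  assumes "finite G"
  shows "\<sigma> \<in> weak_compositions G k \<longleftrightarrow> \<sigma> \<in> extensional G \<and> sum \<sigma> G = k"
  using assms member_le_sum[of _ G \<sigma>]
  by (auto simp: weak_compositions_def PiE_def)

lemma finite_weak_compositions: "finite G \<Longrightarrow> finite (weak_compositions G k)"
  unfolding weak_compositions_def by (rule finite_subset[of _ "G \<rightarrow>\<^sub>E {0..k}"]) (auto intro: finite_PiE)

lemma weak_compositions_0:
  assumes "finite G"
  shows "weak_compositions G 0 = {\<lambda>g\<in>G. 0}"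
  using assms by (auto simp: weak_compositions_iff extensional_def fun_eq_iff)

definition increment :: "'a \<Rightarrow> ('a \<Rightarrow> nat) \<Rightarrow> 'a \<Rightarrow> nat" where
  "increment g \<tau> = \<tau>(g := Suc (\<tau> g))"

lemma sum_increment:
  fixes f :: "'a \<Rightarrow> 'b :: comm_semiring_1"
  assumes "finite G" "g \<in> G"
  shows "(\<Sum>x\<in>G. f x * of_nat (increment g \<tau> x)) = (\<Sum>x\<in>G. f x * of_nat (\<tau> x)) + f g"
proof -
  have "(\<Sum>x\<in>G. f x * of_nat (increment g \<tau> x))
      = (\<Sum>x\<in>G. f x * of_nat (\<tau> x) + (if x = g then f g else 0))"
    by (intro sum.cong) (auto simp: increment_def algebra_simps)
  then show ?thesis
    using assms by (simp add: sum.distrib)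
qed

lemma prod_increment:
  fixes f :: "'a \<Rightarrow> nat \<Rightarrow> 'b :: comm_monoid_mult"
  assumes "finite G" "g \<in> G" "f g (Suc (\<tau> g)) = a * f g (\<tau> g)"
  shows "(\<Prod>x\<in>G. f x (increment g \<tau> x)) = a * (\<Prod>x\<in>G. f x (\<tau> x))"
proof -
  have "(\<Prod>x\<in>G. f x (increment g \<tau> x)) = (\<Prod>x\<in>G. (if x = g then a else 1) * f x (\<tau> x))"
    using assms by (intro prod.cong) (auto simp: increment_def)
  then show ?thesis
    using assms by (simp add: prod.distrib)
qed

lemma bij_betw_increment:
  assumes "finite G" "g \<in> G"
  shows "bij_betw (increment g) (weak_compositions G k)
           {\<sigma> \<in> weak_compositions G (Suc k). \<sigma> g \<noteq> 0}"
proof (rule bij_betw_byWitness[where f' = "\<lambda>\<sigma>. \<sigma>(g := \<sigma> g - 1)"])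
  have sum_inc: "sum (increment g \<tau>) G = Suc (sum \<tau> G)" for \<tau>
    using sum_increment[OF assms, of "\<lambda>_. 1 :: nat" \<tau>] by simp
  show "increment g ` weak_compositions G k \<subseteq> {\<sigma> \<in> weak_compositions G (Suc k). \<sigma> g \<noteq> 0}"
    using assms by (auto simp: weak_compositions_iff sum_inc) (auto simp: increment_def extensional_def)
  have inc_dec: "increment g (\<sigma>(g := \<sigma> g - 1)) = \<sigma>" if "\<sigma> g \<noteq> 0" for \<sigma>
    using that by (auto simp: increment_def)
  then show "\<forall>\<sigma>\<in>{\<sigma> \<in> weak_compositions G (Suc k). \<sigma> g \<noteq> 0}. increment g (\<sigma>(g := \<sigma> g - 1)) = \<sigma>"
    by simp
  show "(\<lambda>\<sigma>. \<sigma>(g := \<sigma> g - 1)) ` {\<sigma> \<in> weak_compositions G (Suc k). \<sigma> g \<noteq> 0} \<subseteq> weak_compositions G k"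
  proof (rule image_subsetI)
    fix \<sigma> assume \<sigma>: "\<sigma> \<in> {\<sigma> \<in> weak_compositions G (Suc k). \<sigma> g \<noteq> 0}"
    have "Suc (sum (\<sigma>(g := \<sigma> g - 1)) G) = sum \<sigma> G"
      using sum_inc[of "\<sigma>(g := \<sigma> g - 1)"] inc_dec[of \<sigma>] \<sigma> by simp
    then show "\<sigma>(g := \<sigma> g - 1) \<in> weak_compositions G k"
      using \<sigma> assms by (auto simp: weak_compositions_iff extensional_def)
  qed
qed (auto simp: increment_def)

text \<open>
  With \<open>F\<close> the indicator of a single \<open>\<sigma>\<close> this is Pascal's rule for multinomial coefficients. The
  reason is that the coefficient of \<open>\<tau>\<close> is \<open>\<sigma> g / (k + 1)\<close> times that of \<open>\<sigma> = increment g \<tau>\<close>,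
  and these fractions add up to \<open>1\<close> over \<open>g\<close>.
\<close>

lemma sum_multinomial_Suc:
  fixes F :: "('a \<Rightarrow> nat) \<Rightarrow> 'b :: field_char_0"
  assumes "finite G"
  shows "(\<Sum>\<sigma>\<in>weak_compositions G (Suc k). fact (Suc k) / (\<Prod>x\<in>G. fact (\<sigma> x)) * F \<sigma>)
       = (\<Sum>g\<in>G. \<Sum>\<tau>\<in>weak_compositions G k. fact k / (\<Prod>x\<in>G. fact (\<tau> x)) * F (increment g \<tau>))"
proof -
  define T where "T \<sigma> = fact k / (\<Prod>x\<in>G. fact (\<sigma> x)) * F \<sigma>" for \<sigma>
  let ?W = "weak_compositions G (Suc k)"
  have step: "(\<Sum>\<tau>\<in>weak_compositions G k. fact k / (\<Prod>x\<in>G. fact (\<tau> x)) * F (increment g \<tau>))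
      = (\<Sum>\<sigma>\<in>?W. of_nat (\<sigma> g) * T \<sigma>)" if g: "g \<in> G" for g
  proof -
    have "fact k / (\<Prod>x\<in>G. fact (\<tau> x)) * F (increment g \<tau>)
        = of_nat (increment g \<tau> g) * T (increment g \<tau>)" for \<tau>
    proof -
      have "(\<Prod>x\<in>G. fact (increment g \<tau> x) :: 'b) = of_nat (Suc (\<tau> g)) * (\<Prod>x\<in>G. fact (\<tau> x))"
        by (rule prod_increment[OF assms g]) simp
      moreover have "(of_nat (Suc (\<tau> g)) :: 'b) \<noteq> 0"
        by (rule of_nat_neq_0)
      ultimately show ?thesis
        by (simp add: T_def increment_def del: of_nat_Suc)
    qed
    then have "(\<Sum>\<tau>\<in>weak_compositions G k. fact k / (\<Prod>x\<in>G. fact (\<tau> x)) * F (increment g \<tau>))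
        = (\<Sum>\<tau>\<in>weak_compositions G k. of_nat (increment g \<tau> g) * T (increment g \<tau>))"
      by simp
    also have "\<dots> = (\<Sum>\<sigma>\<in>{\<sigma> \<in> ?W. \<sigma> g \<noteq> 0}. of_nat (\<sigma> g) * T \<sigma>)"
      by (rule sum.reindex_bij_betw[OF bij_betw_increment[OF assms g]])
    also have "\<dots> = (\<Sum>\<sigma>\<in>?W. of_nat (\<sigma> g) * T \<sigma>)"
      by (rule sum.mono_neutral_left) (auto simp: finite_weak_compositions assms)
    finally show ?thesis .
  qed
  have "(\<Sum>g\<in>G. \<Sum>\<tau>\<in>weak_compositions G k. fact k / (\<Prod>x\<in>G. fact (\<tau> x)) * F (increment g \<tau>))
      = (\<Sum>g\<in>G. \<Sum>\<sigma>\<in>?W. of_nat (\<sigma> g) * T \<sigma>)"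
    using step by simp
  also have "\<dots> = (\<Sum>\<sigma>\<in>?W. of_nat (sum \<sigma> G) * T \<sigma>)"
    by (subst sum.swap) (simp add: sum_distrib_right)
  also have "\<dots> = (\<Sum>\<sigma>\<in>?W. of_nat (Suc k) * T \<sigma>)"
    by (rule sum.cong) (auto simp: weak_compositions_def)
  finally show ?thesis
    by (simp add: T_def mult_ac)
qed

section \<open>The explicit solution\<close>

lemma finite_grid: "finite (grid n m)"
  by (simp add: grid_def)

text \<open>The lower bound is \<open>Suc 0\<close>, the simplifier's normal form of \<open>1\<close>, so that these rewrite.\<close>

lemma sum_grid: "(\<Sum>u=Suc 0..n. \<Sum>v=Suc 0..m. f u v) = (\<Sum>(u, v)\<in>grid n m. f u v)"
  by (simp add: grid_def sum.cartesian_product)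

lemma prod_grid: "(\<Prod>u=Suc 0..n. \<Prod>v=Suc 0..m. f u v) = (\<Prod>(u, v)\<in>grid n m. f u v)"
  by (simp add: grid_def prod.cartesian_product)

lemma multi_indices_eq: "multi_indices n m k = weak_compositions (grid n m) k"
  by (simp add: multi_indices_def weak_compositions_def sum_grid)

lemma multinomial_eq: "multinomial n m k \<sigma> = fact k / (\<Prod>g\<in>grid n m. fact (\<sigma> g))"
  by (simp add: multinomial_def prod_grid)

lemma shift_a_increment:
  assumes "(u, v) \<in> grid n m"
  shows "shift_a n m s (Suc k) (increment (u, v) \<tau>) = shift_a n m s k \<tau> + s + 1 - int u"
  using sum_increment[OF finite_grid assms, of "\<lambda>g. int (fst g)" \<tau>]
  by (simp add: shift_a_def sum_grid case_prod_beta algebra_simps)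

lemma shift_b_increment:
  assumes "(u, v) \<in> grid n m"
  shows "shift_b n m t (Suc k) (increment (u, v) \<tau>) = shift_b n m t k \<tau> + t + 1 - int v"
  using sum_increment[OF finite_grid assms, of "\<lambda>g. int (snd g)" \<tau>]
  by (simp add: shift_b_def sum_grid case_prod_beta algebra_simps)

definition multinomial_solution ::
  "nat \<Rightarrow> nat \<Rightarrow> int \<Rightarrow> int \<Rightarrow> (nat \<Rightarrow> nat \<Rightarrow> complex) \<Rightarrow> (int \<Rightarrow> int \<Rightarrow> complex)
     \<Rightarrow> int \<Rightarrow> int \<Rightarrow> nat \<Rightarrow> complex" where
  "multinomial_solution n m s t c \<Psi> i j k =
     (\<Sum>\<sigma>\<in>multi_indices n m k.
        multinomial n m k \<sigma> * \<Psi> (i - shift_a n m s k \<sigma>) (j - shift_b n m t k \<sigma>) *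
        (\<Prod>u=1..n. \<Prod>v=1..m. c u v ^ \<sigma> (u, v)))"

lemma multinomial_solution_0: "multinomial_solution n m s t c \<Psi> i j 0 = \<Psi> i j"
proof -
  have "shift_a n m s 0 (\<lambda>g\<in>grid n m. 0) = 0" "shift_b n m t 0 (\<lambda>g\<in>grid n m. 0) = 0"
    by (auto simp: shift_a_def shift_b_def sum_grid intro!: sum.neutral)
  moreover have "multinomial n m 0 (\<lambda>g\<in>grid n m. 0) = 1"
    by (simp add: multinomial_eq)
  moreover have "(\<Prod>u=1..n. \<Prod>v=1..m. c u v ^ (\<lambda>g\<in>grid n m. 0) (u, v)) = 1"
    by (auto simp: prod_grid intro!: prod.neutral)
  ultimately show ?thesis
    by (simp add: multinomial_solution_def multi_indices_eq weak_compositions_0 finite_grid)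
qed

lemma multinomial_solution_solves:
  "solves_difference_eq n m s t c (multinomial_solution n m s t c \<Psi>)"
  unfolding solves_difference_eq_def
proof (intro allI)
  fix i j k
  let ?G = "grid n m"
  let ?V = "multinomial_solution n m s t c \<Psi>"
  define P where "P \<sigma> = (\<Prod>u=1..n. \<Prod>v=1..m. c u v ^ \<sigma> (u, v))" for \<sigma>
  define F where "F \<sigma> = \<Psi> (i + s - shift_a n m s (Suc k) \<sigma>) (j + t - shift_b n m t (Suc k) \<sigma>) * P \<sigma>" for \<sigma>
  have F_increment: "F (increment (u, v) \<tau>) = c u v *
      (\<Psi> (i + int u - 1 - shift_a n m s k \<tau>) (j + int v - 1 - shift_b n m t k \<tau>) * P \<tau>)"
    if uv: "(u, v) \<in> ?G" for u v \<tau>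
  proof -
    have "P (increment (u, v) \<tau>) = c u v * P \<tau>"
      using prod_increment[OF finite_grid uv, of "\<lambda>(u, v) e. c u v ^ e" \<tau> "c u v"]
      by (simp add: P_def prod_grid case_prod_beta)
    then show ?thesis
      by (simp add: F_def shift_a_increment[OF uv] shift_b_increment[OF uv] algebra_simps)
  qed
  have "?V (i + s) (j + t) (k + 1)
      = (\<Sum>\<sigma>\<in>weak_compositions ?G (Suc k). fact (Suc k) / (\<Prod>x\<in>?G. fact (\<sigma> x)) * F \<sigma>)"
    by (simp add: multinomial_solution_def multi_indices_eq multinomial_eq F_def P_def mult.assoc)
  also have "\<dots> = (\<Sum>g\<in>?G. \<Sum>\<tau>\<in>weak_compositions ?G k.
      fact k / (\<Prod>x\<in>?G. fact (\<tau> x)) * F (increment g \<tau>))"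
    by (rule sum_multinomial_Suc[OF finite_grid])
  also have "\<dots> = (\<Sum>(u, v)\<in>?G. c u v * ?V (i + int u - 1) (j + int v - 1) k)"
  proof (rule sum.cong[OF refl], clarify)
    fix u v assume "(u, v) \<in> ?G"
    then show "(\<Sum>\<tau>\<in>weak_compositions ?G k. fact k / (\<Prod>x\<in>?G. fact (\<tau> x)) * F (increment (u, v) \<tau>))
        = c u v * ?V (i + int u - 1) (j + int v - 1) k"
      by (simp add: F_increment multinomial_solution_def multi_indices_eq multinomial_eq P_def
          sum_distrib_left mult_ac)
  qed
  finally show "?V (i + s) (j + t) (k + 1)
      = (\<Sum>u=1..n. \<Sum>v=1..m. c u v * ?V (i + int u - 1) (j + int v - 1) k)"
    by (simp add: sum_grid)
qed

section \<open>Uniqueness of the solution\<close>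

lemma solution_unique:
  assumes U: "solves_difference_eq n m s t c U" and V: "solves_difference_eq n m s t c V"
    and initial: "\<And>i j. U i j 0 = V i j 0"
  shows "U i j k = V i j k"
proof (induction k arbitrary: i j)
  case 0
  show ?case by (rule initial)
next
  case (Suc k)
  \<comment> \<open>The equation gives the value at a shifted point, so it is used at \<open>(i - s, j - t)\<close>.\<close>
  have "W i j (Suc k) = (\<Sum>u=1..n. \<Sum>v=1..m. c u v * W (i - s + int u - 1) (j - t + int v - 1) k)"
    if "solves_difference_eq n m s t c W" for W
    using that[unfolded solves_difference_eq_def, rule_format, of "i - s" "j - t" k] by simp
  from this[OF U] this[OF V] show ?case
    by (simp add: Suc.IH)
qed

theorem theorem4p2:
  fixes n m :: nat and s t :: int
    and c :: "nat \<Rightarrow> nat \<Rightarrow> complex"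
    and \<Psi> :: "int \<Rightarrow> int \<Rightarrow> complex"
    and U :: "int \<Rightarrow> int \<Rightarrow> nat \<Rightarrow> complex"
  assumes "n \<ge> 1" and "m \<ge> 1"
  shows "solves_difference_eq n m s t c U \<and> (\<forall>i j. U i j 0 = \<Psi> i j) \<longleftrightarrow>
    (\<forall>i j k. U i j k =
      (\<Sum>\<sigma>\<in>multi_indices n m k.
         multinomial n m k \<sigma> * \<Psi> (i - shift_a n m s k \<sigma>) (j - shift_b n m t k \<sigma>) *
         (\<Prod>u=1..n. \<Prod>v=1..m. c u v ^ \<sigma> (u, v))))"
proof -
  let ?V = "multinomial_solution n m s t c \<Psi>"
  have "solves_difference_eq n m s t c U \<and> (\<forall>i j. U i j 0 = \<Psi> i j) \<longleftrightarrow> (\<forall>i j k. U i j k = ?V i j k)"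
  proof
    assume "solves_difference_eq n m s t c U \<and> (\<forall>i j. U i j 0 = \<Psi> i j)"
    then show "\<forall>i j k. U i j k = ?V i j k"
      using solution_unique[OF _ multinomial_solution_solves] by (simp add: multinomial_solution_0)
  next
    assume "\<forall>i j k. U i j k = ?V i j k"
    then have "U = ?V"
      by (intro ext) simp
    then show "solves_difference_eq n m s t c U \<and> (\<forall>i j. U i j 0 = \<Psi> i j)"
      by (simp add: multinomial_solution_solves multinomial_solution_0)
  qed
  then show ?thesis
    by (simp only: multinomial_solution_def)
qed

end
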